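(* Let $P_{\max}$, $\varphi$, and $S_n$ (for every $n\in\mathbb{N}$) be defined as in the context for a given photovoltaic (PV) system. Consider a resource agent for this PV system that (i) uses a persistent predictor to advertise $\mathcal{A}_{n+1}:=S_n$, and (ii) implements setpoints according to the greedy (error diffusion) algorithm. Then $D=\mathcal{T}(P_{\max})$ is the minimal $F$-invariant set with respect to $\mathbb{S}=\{\mathcal{T}(x)\}_{0\le x\le P_{\max}}$. Therefore, if $e_0\in D$, the accumulated error for this resource agent is bounded by $$\|e_n\|\le\operatorname{diam}D=\max\Big\{\frac{P_{\max}}{\cos\varphi},\,2P_{\max}\tan\varphi\Big\}$$ for all $n\in\mathbb{N}$.
   Context: PV system: $S_{\mathrm{rated}}\ge0$ is the rated power of the converter and $\phi_{\max}$, with $0\le\phi_{\max}<\pi$, is the angle corresponding to the minimum power factor. The numbers $P_{\max},\varphi\in\mathbb{R}$ are chosen such that $0\le P_{\max}\le S_{\mathrm{rated}}$, $0\le\varphi\le\phi_{\max}$ and $P_{\max}/\cos\varphi=S_{\mathrm{rated}}$. Let $\mathcal{T}(x):=\{(P,Q)\in\mathbb{R}^2:0\le P\le x,\ |Q|/P\le\tan\varphi\}$, a triangle with a vertex at the origin (at $P=0$ the condition is read as $|Q|\le P\tan\varphi$). Let $p^{\max}_n$ be the maximum real power available at timestep $n\in\mathbb{N}$, and let $S_n:=\mathcal{T}(\min(p^{\max}_n,P_{\max}))$ be the set of implementable points at timestep $n$. $\mathbb{N}$ includes $0$. Dynamics: at timestep $n$ the agent receives a requested setpoint $x_n\in\mathcal{A}_n$,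 where $\mathcal{A}_n$ is the previously advertised set (so $x_{n+1}\in\mathcal{A}_{n+1}=S_n$). It implements $y_n\in S_n$, the closest point to $e_n+x_n$ in $S_n$ (greedy/error diffusion algorithm). The accumulated error is $e_{n+1}=e_n+x_n-y_n$. $\|\cdot\|$ is the Euclidean norm, $\operatorname{diam}D=\max\{\|v-w\|:v,w\in D\}$, and $\operatorname{conv}$ denotes convex hull. For a non-empty closed set $S\subset\mathbb{R}^2$, $\mathrm{Vor}_S(z)$ denotes a closest point of $z$ in $S$. For $x\in\operatorname{conv}S$, let $F_{S,x}(z)=z+x-\mathrm{Vor}_S(z)$. A set $D\subseteq\mathbb{R}^2$ is $F$-invariant with respect to $S$ if $F_{S,x}(D)\subseteq D$ for all $x\in\operatorname{conv}S$, and $F$-invariant with respect to a collection $\mathbb{S}$ if it is so with respect to every $S\in\mathbb{S}$. Convention: "set" means closed set unless explicitly specified otherwise.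
   Formalization: The error bound also assumes e_0+x_0 ∈ D, as it fails with e_0 ∈ D alone (φ=0, P_max=1, e_0=x_0=(1,0), S_0={0} gives ‖e_1‖=2>1); "the" minimal set is shown to be contained in every non-empty invariant set only if P_max, φ>0, as this fails otherwise. *)

theory Defs
  imports "HOL-Analysis.Analysis"
begin

text \<open>Points \<open>(P, Q)\<close> of the plane have type \<open>real \<times> real\<close>, whose norm is the Euclidean one.\<close>

text \<open>The condition \<open>\<bar>Q\<bar> / P \<le> tan \<phi>\<close> is written multiplied out, which fixes its meaning at
  \<open>P = 0\<close> as \<open>Q = 0\<close>.\<close>

definition pv_triangle :: "real \<Rightarrow> real \<Rightarrow> (real \<times> real) set" where
  "pv_triangle \<phi> x = {(P, Q). 0 \<le> P \<and> P \<le> x \<and> \<bar>Q\<bar> \<le> P * tan \<phi>}"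

definition diffusion_map :: "(real \<times> real) set \<Rightarrow> real \<times> real \<Rightarrow> real \<times> real \<Rightarrow> real \<times> real" where
  "diffusion_map S x z = z + x - closest_point S z"

definition F_invariant :: "(real \<times> real) set \<Rightarrow> (real \<times> real) set \<Rightarrow> bool" where
  "F_invariant S D \<longleftrightarrow> (\<forall>x \<in> convex hull S. diffusion_map S x ` D \<subseteq> D)"

definition F_invariant_coll :: "(real \<times> real) set set \<Rightarrow> (real \<times> real) set \<Rightarrow> bool" where
  "F_invariant_coll SS D \<longleftrightarrow> (\<forall>S \<in> SS. F_invariant S D)"

text \<open>Candidates are closed and non-empty: the empty set is vacuously invariant.\<close>

definition minimal_F_invariant :: "(real \<times> real) set set \<Rightarrow> (real \<times> real) set \<Rightarrow> bool" where
  "minimal_F_invariant SS D \<longleftrightarrow>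
     closed D \<and> D \<noteq> {} \<and> F_invariant_coll SS D \<and>
     (\<forall>D'. closed D' \<and> D' \<noteq> {} \<and> F_invariant_coll SS D' \<and> D' \<subseteq> D \<longrightarrow> D' = D)"

text \<open>In the next two definitions, at timestep \<open>n\<close>, \<open>S n\<close> is the set of implementable points,
  \<open>A n\<close> the previously advertised set, \<open>x n\<close> the request, \<open>y n\<close> the implemented point and
  \<open>e n\<close> the accumulated error.\<close>

definition persistent_predictor ::
  "(nat \<Rightarrow> (real \<times> real) set) \<Rightarrow> (nat \<Rightarrow> (real \<times> real) set) \<Rightarrow> bool" where
  "persistent_predictor S A \<longleftrightarrow> (\<forall>n. A (Suc n) = S n)"

text \<open>The conjunct \<open>y n \<in> S n\<close> is not redundant: \<^const>\<open>closest_point\<close> is arbitrary on the empty set.\<close>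

definition greedy_agent ::
  "(nat \<Rightarrow> (real \<times> real) set) \<Rightarrow> (nat \<Rightarrow> (real \<times> real) set) \<Rightarrow>
   (nat \<Rightarrow> real \<times> real) \<Rightarrow> (nat \<Rightarrow> real \<times> real) \<Rightarrow> (nat \<Rightarrow> real \<times> real) \<Rightarrow> bool" where
  "greedy_agent S A x y e \<longleftrightarrow>
     (\<forall>n. x n \<in> A n \<and> y n \<in> S n \<and> y n = closest_point (S n) (e n + x n) \<and>
          e (Suc n) = e n + x n - y n)"

end

theory Submission
  imports Defs
begin

text \<open>Write \<open>T(c)\<close> for \<^term>\<open>pv_triangle \<phi> c\<close>. A point of \<open>T(X)\<close> to the right of \<open>T(c)\<close> is projected
  onto the vertical edge of \<open>T(c)\<close> by clamping its second coordinate, so the residual lies in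
  \<open>T(X - c)\<close>, and \<open>T(X - c) + T(c) \<subseteq> T(X)\<close> gives invariance. Conversely, an invariant set meeting
  \<open>T(X)\<close> contains it, since a point of \<open>T(X)\<close> is its own projection. A closed invariant set does
  meet \<open>T(X)\<close>: let \<open>z\<close> be one of its points nearest to \<open>T(X)\<close>, with residual \<open>e\<close>. Every \<open>e + x\<close> with
  \<open>x \<in> T(X)\<close> belongs to the invariant set, so \<open>x\<close> is a nearest point to \<open>e + x\<close>, and \<open>e\<close> is an outer
  normal of \<open>T(X)\<close> at each of its points; this forces \<open>e = 0\<close>.\<close>

section \<open>Algebra and topology of the triangles\<close>

lemma mem_pv_triangle:
  "(P, Q) \<in> pv_triangle \<phi> x \<longleftrightarrow> 0 \<le> P \<and> P \<le> x \<and> \<bar>Q\<bar> \<le> P * tan \<phi>"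
  by (simp add: pv_triangle_def)

lemma zero_in_pv_triangle: "0 \<le> x \<Longrightarrow> 0 \<in> pv_triangle \<phi> x"
  by (simp add: zero_prod_def mem_pv_triangle)

lemma pv_triangle_zero: "pv_triangle \<phi> 0 = {0}"
  by (auto simp: pv_triangle_def zero_prod_def)

lemma pv_triangle_mono: "x \<le> y \<Longrightarrow> pv_triangle \<phi> x \<subseteq> pv_triangle \<phi> y"
  by (auto simp: pv_triangle_def)

lemma pv_triangle_add:
  assumes "u \<in> pv_triangle \<phi> x" "v \<in> pv_triangle \<phi> y"
  shows "u + v \<in> pv_triangle \<phi> (x + y)"
  using assms by (cases u; cases v) (auto simp: mem_pv_triangle distrib_right)

lemma compact_pv_triangle: "compact (pv_triangle \<phi> x)"
proof -
  have "pv_triangle \<phi> x = {u. 0 \<le> fst u} \<inter> {u. fst u \<le> x} \<inter> {u. \<bar>snd u\<bar> \<le> fst u * tan \<phi>}"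
    by (auto simp: pv_triangle_def)
  then have "closed (pv_triangle \<phi> x)"
    by (auto intro!: closed_Int closed_Collect_le continuous_intros)
  \<comment> \<open>\<open>tan \<phi>\<close> may be negative here, hence the absolute
    value.\<close>
  moreover have "norm u \<le> x + x * \<bar>tan \<phi>\<bar>" if "u \<in> pv_triangle \<phi> x" for u
  proof -
    obtain P Q where u: "u = (P, Q)" by (cases u)
    then have "P \<le> x" "0 \<le> P" "\<bar>Q\<bar> \<le> P * tan \<phi>"
      using that by (auto simp: mem_pv_triangle)
    moreover have "P * tan \<phi> \<le> x * \<bar>tan \<phi>\<bar>"
      using calculation mult_left_mono[OF abs_ge_self[of "tan \<phi>"], of P]
        mult_right_mono[of P x "\<bar>tan \<phi>\<bar>"] by simp
    ultimately show ?thesis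
      using norm_Pair_le[of P Q] u by simp
  qed
  ultimately show ?thesis
    by (meson compact_eq_bounded_closed boundedI)
qed

text \<open>Scaling by \<open>c \<ge> 0\<close> maps T(x) into T(\<open>c * x\<close>), so a convex
  combination lies in T(\<open>a * x\<close>) + T(\<open>b * x\<close>).\<close>

lemma convex_pv_triangle: "convex (pv_triangle \<phi> x)"
proof (rule convexI)
  fix v w :: "real \<times> real" and a b :: real
  assume v: "v \<in> pv_triangle \<phi> x" and w: "w \<in> pv_triangle \<phi> x"
    and ab: "0 \<le> a" "0 \<le> b" "a + b = 1"
  have scale: "c *\<^sub>R u \<in> pv_triangle \<phi> (c * x)"
    if "u \<in> pv_triangle \<phi> x" "0 \<le> c" for c u
    using that by (cases u) (auto simp: mem_pv_triangle abs_mult mult.assoc intro: mult_left_mono)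
  have "a *\<^sub>R v + b *\<^sub>R w \<in> pv_triangle \<phi> (a * x + b * x)"
    using v w ab by (intro pv_triangle_add scale)
  also have "a * x + b * x = x"
    using ab by (metis distrib_right mult_1)
  finally show "a *\<^sub>R v + b *\<^sub>R w \<in> pv_triangle \<phi> x" .
qed

lemmas closed_pv_triangle = compact_imp_closed[OF compact_pv_triangle]

section \<open>Projection onto a smaller triangle\<close>

lemma tan_nonneg_if_mem_pv_triangle:
  assumes "(P, Q) \<in> pv_triangle \<phi> x" "0 < P"
  shows "0 \<le> tan \<phi>"
proof -
  have "0 \<le> P * tan \<phi>"
    using assms abs_ge_zero[of Q] by (auto simp: mem_pv_triangle)
  then show ?thesis
    using assms(2) by (simp add: zero_le_mult_iff)
qed

text \<open>T(c) lies in a rectangle of width \<open>c\<close> and half-height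
  \<open>c * tan \<phi>\<close>, and it contains the right edge of that rectangle. Beyond this edge,
  projecting onto the rectangle lands on the edge, hence in T(c).\<close>

lemma closest_point_pv_triangle:
  assumes "(P, Q) \<in> pv_triangle \<phi> x" "0 \<le> c" "c < P"
  shows "closest_point (pv_triangle \<phi> c) (P, Q) = (c, max (- (c * tan \<phi>)) (min (c * tan \<phi>) Q))"
    (is "_ = (c, ?q)")
proof -
  have t: "0 \<le> tan \<phi>"
    using tan_nonneg_if_mem_pv_triangle[OF assms(1)] assms by simp
  have "(c, ?q) = closest_point (pv_triangle \<phi> c) (P, Q)"
  proof (rule closest_point_unique[OF convex_pv_triangle closed_pv_triangle])
    show "(c, ?q) \<in> pv_triangle \<phi> c"
      using assms t by (auto simp: mem_pv_triangle abs_le_iff)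
    show "\<forall>z\<in>pv_triangle \<phi> c. dist (P, Q) (c, ?q) \<le> dist (P, Q) z"
    proof (clarify, goal_cases)
      case (1 p q)
      then have p: "p \<le> c" "\<bar>q\<bar> \<le> p * tan \<phi>"
        by (auto simp: mem_pv_triangle)
      then have "\<bar>q\<bar> \<le> c * tan \<phi>"
        using mult_right_mono[OF p(1) t] by linarith
      then have "\<bar>Q - ?q\<bar> \<le> \<bar>Q - q\<bar>"
        by (auto simp: max_def min_def)
      moreover have "\<bar>P - c\<bar> \<le> \<bar>P - p\<bar>"
        using p assms by linarith
      ultimately show ?case
        by (simp add: dist_Pair_Pair dist_real_def abs_le_square_iff add_mono)
    qed
  qed
  then show ?thesis by simp
qed

text \<open>After clamping, the second coordinate has absolute value
  \<open>max (\<bar>Q\<bar> - c * tan \<phi>) 0\<close>, which is at most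
  \<open>(P - c) * tan \<phi>\<close>.\<close>

lemma residual_in_pv_triangle:
  assumes "(P, Q) \<in> pv_triangle \<phi> x" "0 \<le> c" "c < P"
  shows "(P, Q) - closest_point (pv_triangle \<phi> c) (P, Q) \<in> pv_triangle \<phi> (x - c)"
  using assms mult_right_mono[OF less_imp_le[OF assms(3)] tan_nonneg_if_mem_pv_triangle[OF assms(1)]]
  by (auto simp: closest_point_pv_triangle mem_pv_triangle left_diff_distrib max_def min_def
      abs_le_iff)

lemma F_invariant_pv_triangle:
  assumes "0 \<le> c" "c \<le> x"
  shows "F_invariant (pv_triangle \<phi> c) (pv_triangle \<phi> x)"
  unfolding F_invariant_def convex_hull_eq[THEN iffD2, OF convex_pv_triangle]
proof (intro ballI image_subsetI)
  fix u z
  assume u: "u \<in> pv_triangle \<phi> c" and z: "z \<in> pv_triangle \<phi> x"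
  show "diffusion_map (pv_triangle \<phi> c) u z \<in> pv_triangle \<phi> x"
  proof (cases "z \<in> pv_triangle \<phi> c")
    case True
    then show ?thesis
      using u pv_triangle_mono[OF assms(2)] by (auto simp: diffusion_map_def closest_point_self)
  next
    case False
    obtain P Q where PQ: "z = (P, Q)" by (cases z)
    then have "c < P"
      using False z by (auto simp: mem_pv_triangle)
    then have "z - closest_point (pv_triangle \<phi> c) z + u \<in> pv_triangle \<phi> (x - c + c)"
      using z u assms unfolding PQ by (intro pv_triangle_add residual_in_pv_triangle)
    then show ?thesis
      by (simp add: diffusion_map_def algebra_simps)
  qed
qed

section \<open>Sets invariant under the diffusion map\<close>

lemma F_invariant_superset:
  assumes "F_invariant S D" "z \<in> S" "z \<in> D"
  shows "S \<subseteq> D"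
proof
  fix x assume "x \<in> S"
  then have "diffusion_map S x z \<in> D"
    using assms hull_inc[of x S convex] unfolding F_invariant_def by blast
  then show "x \<in> D"
    using assms(2) by (simp add: diffusion_map_def closest_point_self)
qed

lemma F_invariant_normal_vector:
  assumes S: "compact S" "convex S" "S \<noteq> {}"
    and D: "closed D" "D \<noteq> {}" "F_invariant S D"
  obtains z where "z \<in> D"
    "\<And>v w. v \<in> S \<Longrightarrow> w \<in> S \<Longrightarrow> inner (z - closest_point S z) (v - w) = 0"
proof -
  obtain p z where z: "p \<in> S" "z \<in> D" "dist p z = setdist S D"
    using setdist_compact_closed[OF S(1) D(1) S(3) D(2)] by metis
  define e where "e = z - closest_point S z"
  note clS = compact_imp_closed[OF S(1)]
  \<comment> \<open>The residual is no longer than the distance between \<open>S\<close> and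
    \<open>D\<close>, hence no longer than any segment joining the two sets.\<close>
  have "norm e \<le> dist p z"
    using closest_point_le[OF clS z(1), of z] by (simp add: e_def dist_norm norm_minus_commute)
  then have e_le: "norm e \<le> dist q d" if "q \<in> S" "d \<in> D" for q d
    using z(3) setdist_le_dist[OF that] by linarith
  have normal: "inner e (v - w) \<le> 0" if "v \<in> S" "w \<in> S" for v w
  proof -
    have "diffusion_map S w z \<in> D"
      using D(3) z(2) that hull_inc[of w S convex] unfolding F_invariant_def by blast
    then have "e + w \<in> D"
      by (simp add: diffusion_map_def e_def algebra_simps)
    then have "\<forall>q\<in>S. dist (e + w) w \<le> dist (e + w) q"
      using e_le by (metis add_diff_cancel_right' dist_commute dist_norm)
    then show ?thesis
      using any_closest_point_dot[OF S(2) clS that(2,1), of "e + w"] by simp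
  qed
  \<comment> \<open>Exchanging \<open>v\<close> and \<open>w\<close> flips the sign, so both
    inequalities hold.\<close>
  have "inner e (v - w) = 0" if "v \<in> S" "w \<in> S" for v w
    using normal[OF that] normal[OF that(2,1)] by (simp add: inner_diff_right)
  with z(2) show thesis
    unfolding e_def by (rule that)
qed

lemma pv_triangle_subset_F_invariant:
  assumes "0 < x" "0 < tan \<phi>" "closed D" "D \<noteq> {}" "F_invariant (pv_triangle \<phi> x) D"
  shows "pv_triangle \<phi> x \<subseteq> D"
proof -
  let ?S = "pv_triangle \<phi> x"
  have pts: "0 \<in> ?S" "(x, 0) \<in> ?S" "(x, x * tan \<phi>) \<in> ?S"
    using assms by (auto simp: mem_pv_triangle zero_in_pv_triangle)
  then obtain z where z: "z \<in> D"
    and perp: "\<And>v w. v \<in> ?S \<Longrightarrow> w \<in> ?S \<Longrightarrow> inner (z - closest_point ?S z) (v - w) = 0"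
    using F_invariant_normal_vector[OF compact_pv_triangle convex_pv_triangle _ assms(3-5)]
    by (metis empty_iff)
  obtain a b where ab: "z - closest_point ?S z = (a, b)" by fastforce
  \<comment> \<open>The residual is orthogonal to one horizontal and one vertical vector, both
    nonzero because \<open>x\<close> and \<open>tan \<phi>\<close> are positive.\<close>
  have "a = 0" "b = 0"
    using perp[OF pts(2,1)] perp[OF pts(3,2)] assms unfolding ab by auto
  then have "closest_point ?S z = z"
    using ab by (simp add: zero_prod_def[symmetric])
  moreover have "closest_point ?S z \<in> ?S"
    using pts closed_pv_triangle by (blast intro: closest_point_in_set)
  ultimately show ?thesis
    using F_invariant_superset[OF assms(5)] z by simp
qed

section \<open>Diameter of the triangle\<close>

lemma diameter_pv_triangle:
  assumes "0 \<le> x" "0 \<le> tan \<phi>" "0 < cos \<phi>"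
  shows "diameter (pv_triangle \<phi> x) = max (x / cos \<phi>) (2 * x * tan \<phi>)" (is "_ = ?M")
proof (rule antisym)
  let ?t = "tan \<phi>"
  have "1 / cos \<phi> ^ 2 = 1 + ?t ^ 2"
    using assms(3) tan_sec[of \<phi>] by (simp add: inverse_eq_divide power_divide)
  then have side: "(x / cos \<phi>)\<^sup>2 = x\<^sup>2 * (1 + ?t\<^sup>2)"
    by (metis power_divide times_divide_eq_right mult_1_right)
  have M0: "0 \<le> x / cos \<phi>" "0 \<le> 2 * x * ?t" "0 \<le> ?M"
    using assms by (auto simp: le_max_iff_disj)
  \<comment> \<open>The squared lengths of a slanted side and of the vertical edge.\<close>
  have M: "x\<^sup>2 * (1 + ?t\<^sup>2) \<le> ?M\<^sup>2" "x\<^sup>2 * (4 * ?t\<^sup>2) \<le> ?M\<^sup>2"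
    using power_mono[OF max.cobounded1[of "x / cos \<phi>" "2 * x * ?t"] M0(1), of 2]
      power_mono[OF max.cobounded2[of "2 * x * ?t" "x / cos \<phi>"] M0(2), of 2] side
    by (auto simp: power_mult_distrib algebra_simps)
  show "diameter (pv_triangle \<phi> x) \<le> ?M"
  proof (rule diameter_le)
    show "pv_triangle \<phi> x \<noteq> {} \<or> 0 \<le> ?M"
      using M0 by simp
    have bound: "norm ((p, q) - (r, s)) \<le> ?M"
      if "(p, q) \<in> pv_triangle \<phi> x" "(r, s) \<in> pv_triangle \<phi> x" "r \<le> p" for p q r s
    proof -
      have pr: "0 \<le> r" "r \<le> p" "p \<le> x" "\<bar>q\<bar> \<le> p * ?t" "\<bar>s\<bar> \<le> r * ?t"
        using that by (auto simp: mem_pv_triangle)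
      have "\<bar>q - s\<bar> \<le> \<bar>(p + r) * ?t\<bar>"
        using pr by (auto simp: distrib_right)
      then have "(p - r)\<^sup>2 + (q - s)\<^sup>2 \<le> (p - r)\<^sup>2 + (p + r)\<^sup>2 * ?t\<^sup>2"
        by (simp add: abs_le_square_iff power_mult_distrib)
      \<comment> \<open>Convexity in \<open>r\<close>: on \<open>[0, p]\<close> the last bound lies below its chord.\<close>
      also have "\<dots> \<le> p * (p - r) * (1 + ?t\<^sup>2) + p * r * (4 * ?t\<^sup>2)"
      proof -
        have "0 \<le> r * (p - r) * (1 + ?t\<^sup>2)"
          using pr by simp
        then show ?thesis
          by (simp add: algebra_simps power2_eq_square)
      qed
      also have "\<dots> \<le> x\<^sup>2 * max (1 + ?t\<^sup>2) (4 * ?t\<^sup>2)"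
      proof -
        let ?m = "max (1 + ?t\<^sup>2) (4 * ?t\<^sup>2)"
        \<comment> \<open>The weights \<open>p * (p - r)\<close> and \<open>p * r\<close> are
          nonnegative with sum \<open>p\<^sup>2\<close>.\<close>
        have "p * (p - r) * (1 + ?t\<^sup>2) + p * r * (4 * ?t\<^sup>2) \<le> p * (p - r) * ?m + p * r * ?m"
          using pr by (intro add_mono mult_left_mono) auto
        also have "\<dots> = p\<^sup>2 * ?m"
          by (simp add: algebra_simps power2_eq_square)
        also have "\<dots> \<le> x\<^sup>2 * ?m"
          using pr by (intro mult_right_mono power_mono) (auto simp: le_max_iff_disj)
        finally show ?thesis .
      qed
      also have "\<dots> \<le> ?M\<^sup>2"
        using M by (auto simp: max_def)
      finally show ?thesis
        using M0(3) by (simp add: norm_Pair real_le_lsqrt)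
    qed
    fix u v
    assume uv: "u \<in> pv_triangle \<phi> x" "v \<in> pv_triangle \<phi> x"
    show "norm (u - v) \<le> ?M"
      using uv bound[of "fst u" "snd u" "fst v" "snd v"] bound[of "fst v" "snd v" "fst u" "snd u"]
      by (cases "fst v \<le> fst u") (auto simp: norm_minus_commute)
  qed
  \<comment> \<open>These two corners and the origin realise both lengths.\<close>
  have "(x, x * ?t) \<in> pv_triangle \<phi> x" "(x, - (x * ?t)) \<in> pv_triangle \<phi> x"
    using assms by (auto simp: mem_pv_triangle)
  note dist_le = diameter_bounded_bound[OF compact_imp_bounded[OF compact_pv_triangle]]
  have "x\<^sup>2 + (x * ?t)\<^sup>2 = (x / cos \<phi>)\<^sup>2"
    unfolding side by (simp add: power_mult_distrib distrib_left)
  then have "dist (x, x * ?t) 0 = x / cos \<phi>"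
    unfolding dist_norm diff_zero norm_Pair real_norm_def power2_abs using assms by simp
  moreover have "dist (x, x * ?t) (x, - (x * ?t)) = 2 * x * ?t"
    using assms by (simp add: dist_Pair_Pair dist_real_def real_sqrt_mult)
  ultimately show "?M \<le> diameter (pv_triangle \<phi> x)"
    using dist_le[OF \<open>(x, x * ?t) \<in> _\<close> zero_in_pv_triangle[OF assms(1)]]
      dist_le[OF \<open>(x, x * ?t) \<in> _\<close> \<open>(x, - (x * ?t)) \<in> _\<close>] by simp
qed

text \<open>Minimality is with respect to inclusion; being contained in every invariant set is
  stronger and fails in degenerate cases: for \<open>P_max = 0\<close> every set is invariant, and
  for \<open>\<phi> = 0\<close> so are vertical translates of the segment \<open>D\<close>. The
  start \<open>e 0 + x 0\<close> is constrained separately because the predictor says nothing about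
  \<open>A 0\<close>.\<close>

theorem theorem6:
  fixes S_rated \<phi>_max P_max \<phi> :: real
    and D :: "(real \<times> real) set"
    and SS :: "(real \<times> real) set set"
  assumes "0 \<le> S_rated"
    and "0 \<le> \<phi>_max" and "\<phi>_max < pi"
    and "0 \<le> P_max" and "P_max \<le> S_rated"
    and "0 \<le> \<phi>" and "\<phi> \<le> \<phi>_max"
    and "cos \<phi> \<noteq> 0" and "P_max / cos \<phi> = S_rated"
    and "D = pv_triangle \<phi> P_max"
    and "SS = {pv_triangle \<phi> x | x. 0 \<le> x \<and> x \<le> P_max}"
  shows "minimal_F_invariant SS D
    \<and> (0 < P_max \<and> 0 < \<phi> \<longrightarrow>
         (\<forall>D'. closed D' \<and> D' \<noteq> {} \<and> F_invariant_coll SS D' \<longrightarrow> D \<subseteq> D'))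
    \<and> diameter D = max (P_max / cos \<phi>) (2 * P_max * tan \<phi>)
    \<and> (\<forall>(p_max :: nat \<Rightarrow> real) S A x y e.
         S = (\<lambda>n. pv_triangle \<phi> (min (p_max n) P_max)) \<and>
         persistent_predictor S A \<and> greedy_agent S A x y e \<and>
         e 0 \<in> D \<and> e 0 + x 0 \<in> D
         \<longrightarrow> (\<forall>n. norm (e n) \<le> diameter D))"
proof -
  let ?T = "pv_triangle \<phi>"
  note D = \<open>D = ?T P_max\<close> and SS = \<open>SS = _\<close> and P0 = \<open>0 \<le> P_max\<close>
  \<comment> \<open>Here \<open>S_rated \<ge> P_max > 0\<close> rules out a negative cosine, which
    remains possible when \<open>P_max = 0\<close>.\<close>
  have nondeg: "0 < cos \<phi> \<and> \<phi> < pi / 2" if "0 < P_max"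
  proof -
    have "0 < P_max / cos \<phi>"
      using that assms by linarith
    then have "0 < cos \<phi>"
      using that by (simp add: zero_less_divide_iff)
    moreover have "cos \<phi> \<le> 0" if "pi / 2 \<le> \<phi>"
      using that assms cos_monotone_0_pi_le[of "pi / 2" \<phi>] by simp
    ultimately show ?thesis by force
  qed
  have "D \<in> SS"
    using D SS P0 by auto
  have inv: "F_invariant_coll SS D"
    unfolding F_invariant_coll_def SS D using F_invariant_pv_triangle by auto
  have "0 \<in> D"
    using D P0 zero_in_pv_triangle by simp
  have minimal: "minimal_F_invariant SS D"
    unfolding minimal_F_invariant_def
  proof (intro conjI allI impI)
    show "closed D" "D \<noteq> {}" "F_invariant_coll SS D"
      using D closed_pv_triangle \<open>0 \<in> D\<close> inv by auto
    fix D' assume D': "closed D' \<and> D' \<noteq> {} \<and> F_invariant_coll SS D' \<and> D' \<subseteq> D"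
    then obtain z where "z \<in> D'" "z \<in> D" by blast
    then have "D \<subseteq> D'"
      using D' \<open>D \<in> SS\<close> F_invariant_superset unfolding F_invariant_coll_def by blast
    then show "D' = D" using D' by blast
  qed
  have least: "D \<subseteq> D'"
    if "0 < P_max" "0 < \<phi>" "closed D'" "D' \<noteq> {}" "F_invariant_coll SS D'" for D'
  proof -
    have "0 < tan \<phi>"
      using that nondeg by (simp add: tan_gt_zero)
    then show ?thesis
      using that \<open>D \<in> SS\<close> pv_triangle_subset_F_invariant unfolding F_invariant_coll_def D by blast
  qed
  have diam: "diameter D = max (P_max / cos \<phi>) (2 * P_max * tan \<phi>)"
  proof (cases "P_max = 0")
    case True
    then show ?thesis by (simp add: D pv_triangle_zero)
  next
    case False
    then have "0 < cos \<phi>" "\<phi> < pi / 2"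
      using P0 nondeg by auto
    moreover have "0 \<le> tan \<phi>"
      using calculation \<open>0 \<le> \<phi>\<close> by (cases "\<phi> = 0") (auto intro!: less_imp_le[OF tan_gt_zero])
    ultimately show ?thesis
      using diameter_pv_triangle P0 D by simp
  qed
  have bounded: "norm (e n) \<le> diameter D"
    if S: "S = (\<lambda>n. ?T (min (p_max n) P_max))" and A: "persistent_predictor S A"
      and agent: "greedy_agent S A x y e" and init: "e 0 \<in> D" "e 0 + x 0 \<in> D"
    for p_max :: "nat \<Rightarrow> real" and S A x y e n
  proof -
    have y: "y k \<in> S k" "y k = closest_point (S k) (e k + x k)"
      "e (Suc k) = e k + x k - y k" "x (Suc k) \<in> S k" for k
      using agent A unfolding greedy_agent_def persistent_predictor_def by metis+
    have S_sub: "S k \<subseteq> D" for k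
      unfolding S D by (rule pv_triangle_mono) simp
    \<comment> \<open>\<open>p_max\<close> may take negative values, but
      \<open>y k \<in> S k\<close> makes the cap nonnegative.\<close>
    have S_SS: "S k \<in> SS" for k
    proof -
      have "0 \<le> min (p_max k) P_max"
        using y(1)[of k] by (cases "y k") (auto simp: S mem_pv_triangle)
      then show ?thesis unfolding S SS by auto
    qed
    \<comment> \<open>The sums \<open>e k + x k\<close> follow the diffusion map: the next request
      lies in \<open>A (Suc k) = S k\<close>, the very set onto which the current sum is
      projected.\<close>
    have in_D: "e k + x k \<in> D" for k
    proof (induction k)
      case 0
      show ?case by (rule init(2))
    next
      case (Suc k)
      have "diffusion_map (S k) (x (Suc k)) (e k + x k) \<in> D"
        using inv S_SS[of k] Suc hull_inc[OF y(4)[of k], of convex]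
        unfolding F_invariant_coll_def F_invariant_def by blast
      then show ?case
        unfolding diffusion_map_def y(3) y(2)[symmetric] by (simp add: algebra_simps)
    qed
    have dist_le: "dist u v \<le> diameter D" if "u \<in> D" "v \<in> D" for u v
      using that compact_pv_triangle unfolding D
      by (intro diameter_bounded_bound compact_imp_bounded)
    show ?thesis
    proof (cases n)
      case 0
      then show ?thesis using dist_le[OF init(1) \<open>0 \<in> D\<close>] by simp
    next
      case (Suc k)
      \<comment> \<open>The error is the difference of \<open>e k + x k\<close> and
        \<open>y k\<close>, two points of \<open>D\<close>.\<close>
      have "y k \<in> D" using y(1) S_sub by blast
      then show ?thesis
        using dist_le[OF in_D[of k]] by (simp add: Suc y(3) dist_norm)
    qed
  qed
  show ?thesis
    by (intro conjI allI impI minimal diam; elim conjE) (rule least bounded; assumption)+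
qed

end
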